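(* For any integer $n\ge 0$, we have $$DSOME(2n)\equiv \begin{cases} 2\pmod 4, & \text{if } n=48k^2+14k+1 \text{ or } n=48k^2+46k+11 \text{ for some } k\in\mathbb Z,\\ 0\pmod 4, & \text{otherwise}. \end{cases}$$
   Context: $DSOME(n)$ denotes the sum of all the odd parts in all the partitions of $n$ into distinct parts minus the sum of all the even parts in all those same partitions, with $DSOME(0)=0$. Equivalently, $\sum_{n\ge 0}DSOME(n)q^n=\prod_{j\ge1}(1+q^j)\cdot\sum_{m\ge 1}\frac{(-1)^{m-1}q^m}{(1+q^m)^2}$. *)

theory Defs
  imports "HOL-Number_Theory.Number_Theory"
begin

text \<open>
  A partition with distinct parts is determined by its set of parts, so it is represented by a
  finite set of positive natural numbers.  The empty set is the unique such partition of 0.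
\<close>

definition distinct_partitions :: "nat \<Rightarrow> nat set set" where
  "distinct_partitions n = {A. finite A \<and> 0 \<notin> A \<and> \<Sum>A = n}"

definition DSOME :: "nat \<Rightarrow> int" where
  "DSOME n = (\<Sum>A\<in>distinct_partitions n. \<Sum>i\<in>{i \<in> A. odd i}. int i)
           - (\<Sum>A\<in>distinct_partitions n. \<Sum>i\<in>{i \<in> A. even i}. int i)"

text \<open>The outer sums in the definition above range over a finite set.\<close>

lemma finite_distinct_partitions: "finite (distinct_partitions n)"
proof (rule finite_subset)
  show "distinct_partitions n \<subseteq> Pow {..n}"
    using member_le_sum[where f = "\<lambda>i::nat. i"]
    by (fastforce simp: distinct_partitions_def)
qed simp

lemma distinct_partitions_0: "distinct_partitions 0 = {{}}"
  by (auto simp: distinct_partitions_def)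

lemma DSOME_0: "DSOME 0 = 0"
  by (simp add: DSOME_def distinct_partitions_0)

end

theory Submission
  imports Defs "HOL-Computational_Algebra.Polynomial"
begin

text \<open>
  In a partition of \<open>2 * n\<close> the odd parts and the even parts together sum to \<open>2 * n\<close>, so the odd sum
  minus the even sum is \<open>2 * n\<close> minus twice the even sum. The even sum is itself even, hence this
  difference is \<open>2 * n\<close> modulo 4 for every single partition. Summing over all partitions into distinct
  parts gives \<open>DSOME (2 * n) \<equiv> 2 * n * Q (2 * n)\<close> modulo 4, where \<open>Q N\<close> counts the partitions of
  \<open>N\<close> into distinct parts (\<open>DSOME_double_cong\<close>). So \<open>DSOME (2 * n)\<close> is 2 modulo 4 exactly when both
  \<open>n\<close> and \<open>Q (2 * n)\<close> are odd, and 0 modulo 4 otherwise.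

  The parity of \<open>Q\<close> is Euler's pentagonal number theorem read modulo 2: a sign in the expansion of
  \<open>\<Prod>j. 1 - q ^ j\<close> does not affect parity, so its coefficients have the parity of \<open>Q\<close>, whereas
  Euler's theorem says that they are \<open>1\<close> or \<open>-1\<close> at the generalised pentagonal numbers
  \<open>k * (3 * k - 1) / 2\<close> and 0 elsewhere (\<open>odd_card_distinct_partitions_iff\<close>). The infinite product is
  avoided by a finite identity of Shanks, valid for an element of any commutative ring and proved by
  induction (\<open>finite_pentagonal_identity\<close>). In the ring of integer polynomials it yields the
  coefficients below any given degree.

  What is left is to solve \<open>2 * n = k * (3 * k - 1) / 2\<close> with \<open>n\<close> odd. Reduction modulo 8 forces
  \<open>k \<equiv> 4\<close> or \<open>k \<equiv> -1\<close>, and these two classes give the two quadratic families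
  (\<open>odd_half_pentagonal_iff\<close>).
\<close>

section \<open>Reduction to counting partitions\<close>

text \<open>
  Each partition contributes \<open>2 * n\<close> minus twice its even sum. The latter is a multiple of 4,
  written below as 4 times the sum of the halves of the even parts.
\<close>

lemma DSOME_double_cong: "[DSOME (2 * n) = 2 * int n * int (card (distinct_partitions (2 * n)))] (mod 4)"
proof -
  define E where "E A = (\<Sum>i\<in>{i \<in> A. even i}. i div 2)" for A :: "nat set"
  have split: "(\<Sum>i\<in>{i \<in> A. odd i}. int i) - (\<Sum>i\<in>{i \<in> A. even i}. int i) = 2 * int n - 4 * int (E A)"
    if "A \<in> distinct_partitions (2 * n)" for A
  proof -
    have fin: "finite A" and total: "\<Sum>A = 2 * n"
      using that by (auto simp: distinct_partitions_def)
    have evens: "(\<Sum>i\<in>{i \<in> A. even i}. int i) = 2 * int (E A)"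
      unfolding E_def of_nat_sum sum_distrib_left by (rule sum.cong) auto
    have "(\<Sum>i\<in>A. int i) = (\<Sum>i\<in>{i \<in> A. even i}. int i) + (\<Sum>i\<in>{i \<in> A. odd i}. int i)"
    proof -
      have "A = {i \<in> A. even i} \<union> {i \<in> A. odd i}" by blast
      then show ?thesis
        using fin by (metis (no_types, lifting) sum.union_disjoint finite_Un disjoint_iff mem_Collect_eq)
    qed
    moreover have "(\<Sum>i\<in>A. int i) = 2 * int n"
      using arg_cong [OF total, of int] by simp
    ultimately show ?thesis using evens by simp
  qed
  have "DSOME (2 * n) = (\<Sum>A\<in>distinct_partitions (2 * n). 2 * int n - 4 * int (E A))"
    unfolding DSOME_def sum_subtractf [symmetric] by (rule sum.cong) (auto simp: split)
  also have "\<dots> = 2 * int n * int (card (distinct_partitions (2 * n)))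
      + 4 * (- (\<Sum>A\<in>distinct_partitions (2 * n). int (E A)))"
    by (simp add: sum_subtractf sum_distrib_left)
  finally show ?thesis
    by (simp add: cong_iff_dvd_diff)
qed

section \<open>Generalised pentagonal numbers\<close>

definition pentagonal :: "int \<Rightarrow> nat" where
  "pentagonal k = nat (k * (3 * k - 1) div 2)"

lemma double_pentagonal: "2 * int (pentagonal k) = k * (3 * k - 1)"
proof -
  have "0 \<le> k * (3 * k - 1)"
    by (cases "k \<le> 0") (auto intro: mult_nonpos_nonpos)
  moreover have "even (k * (3 * k - 1))" by simp
  ultimately show ?thesis by (simp add: pentagonal_def)
qed

lemma pentagonal_eq_iff: "pentagonal k = N \<longleftrightarrow> k * (3 * k - 1) = 2 * int N"
  using double_pentagonal [of k] by linarith

text \<open>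
  By injectivity no two terms of Euler's series share an exponent, so its coefficients cannot cancel.
  The vanishing of the second factor below would make 3 divide 1.
\<close>

lemma inj_pentagonal: "inj pentagonal"
proof (rule injI)
  fix k l assume "pentagonal k = pentagonal l"
  then have "(k - l) * (3 * (k + l) - 1) = 0"
    using double_pentagonal [of k] double_pentagonal [of l] by (simp add: algebra_simps)
  moreover have "3 * (k + l) - 1 \<noteq> 0" by presburger
  ultimately show "k = l" by simp
qed

text \<open>
  This bound ensures that the part of Euler's series with \<open>\<bar>k\<bar> \<le> N\<close> contains every term of
  degree at most \<open>N\<close>.
\<close>

lemma abs_le_pentagonal: "\<bar>k\<bar> \<le> int (pentagonal k)"
proof (cases "k \<le> 0")
  case True
  have "0 \<le> 3 * (k * (k + 1))"
    using True by (cases "k = 0") (auto intro: mult_nonpos_nonpos)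
  moreover have "k * (3 * k - 1) = 3 * (k * (k + 1)) - 4 * k" by (simp add: algebra_simps)
  ultimately show ?thesis using double_pentagonal [of k] True by linarith
next
  case False
  then have "0 \<le> 3 * (k * (k - 1))" by simp
  moreover have "k * (3 * k - 1) = 3 * (k * (k - 1)) + 2 * k" by (simp add: algebra_simps)
  ultimately show ?thesis using double_pentagonal [of k] False by linarith
qed

section \<open>Euler's pentagonal number theorem\<close>

text \<open>
  Shanks's finite form of Euler's theorem. The summand with \<open>s = 0\<close> is the truncated Euler product
  \<open>\<Prod>j\<in>{0<..n}. 1 - q ^ j\<close>, and every other summand on the left is divisible by \<open>q ^ (n + 1)\<close>.
  Passing from \<open>n\<close> to \<open>n + 1\<close> multiplies the summand of index \<open>s \<le> n\<close> by
  \<open>q ^ s * (1 - q ^ (n + 1))\<close>. The resulting change telescopes over \<open>s\<close>, because the factor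
  \<open>1 - q ^ (s + 1)\<close> that distinguishes the products for \<open>s\<close> and \<open>s + 1\<close> matches the change of the
  exponent. Only the end of the telescope and the new summand of index \<open>n + 1\<close> remain, and these
  are the terms of index \<open>n + 1\<close> and \<open>- (n + 1)\<close> on the right.
\<close>

lemma finite_pentagonal_identity:
  fixes q :: "'a::comm_ring_1"
  shows "(\<Sum>s\<le>n. (- 1) ^ s * q ^ (s * n + s * (s + 1) div 2) * (\<Prod>j\<in>{s<..n}. 1 - q ^ j))
       = (\<Sum>k\<in>{- int n..int n}. (- 1) ^ nat \<bar>k\<bar> * q ^ pentagonal k)"
proof (induction n)
  case 0
  show ?case by (simp add: pentagonal_def)
next
  case (Suc n)
  define c where "c s = (- 1) ^ s * q ^ (s * n + s * (s + 1) div 2)" for s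
  define P where "P s = (\<Prod>j\<in>{s<..n}. 1 - q ^ j)" for s
  have P_n: "P n = 1" by (simp add: P_def)
  have P_step: "P s = (1 - q ^ Suc s) * P (Suc s)" if "s < n" for s
  proof -
    have "{s<..n} = insert (Suc s) {Suc s<..n}" using that by auto
    then show ?thesis by (simp add: P_def)
  qed
  have c_step: "c (Suc s) = - (c s * q ^ Suc n * q ^ s)" for s
  proof -
    have "Suc s * (Suc s + 1) div 2 = s * (s + 1) div 2 + Suc s" by simp
    then show ?thesis by (simp add: c_def power_add algebra_simps)
  qed
  \<comment> \<open>The summand of index \<open>s\<close> is \<open>c s * P s\<close> for \<open>n\<close>, and
     \<open>c s * q ^ s * (1 - q ^ Suc n) * P s\<close> for \<open>Suc n\<close>.\<close>
  have telescope: "(\<Sum>s\<le>m. c s * P s - c s * q ^ s * (1 - q ^ Suc n) * P s)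
       = c m * q ^ m * q ^ Suc n * P m" if "m \<le> n" for m
    using that
  proof (induction m)
    case 0
    show ?case by (simp add: algebra_simps)
  next
    case (Suc m)
    have "(\<Sum>s\<le>Suc m. c s * P s - c s * q ^ s * (1 - q ^ Suc n) * P s)
      = c m * q ^ m * q ^ Suc n * P m + (c (Suc m) * P (Suc m)
          - c (Suc m) * q ^ Suc m * (1 - q ^ Suc n) * P (Suc m))"
      using Suc by simp
    also have "c m * q ^ m * q ^ Suc n * P m = - c (Suc m) * (1 - q ^ Suc m) * P (Suc m)"
      using P_step[of m] Suc.prems by (simp add: c_step mult_ac)
    finally show ?case by (simp add: algebra_simps)
  qed
  have "(\<Sum>s\<le>Suc n. (- 1) ^ s * q ^ (s * Suc n + s * (s + 1) div 2) * (\<Prod>j\<in>{s<..Suc n}. 1 - q ^ j))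
     = (\<Sum>s\<le>n. c s * q ^ s * (1 - q ^ Suc n) * P s) + (- 1) ^ Suc n * q ^ (Suc n * Suc n + Suc n * (Suc n + 1) div 2)"
  proof -
    have "(- 1) ^ s * q ^ (s * Suc n + s * (s + 1) div 2) * (\<Prod>j\<in>{s<..Suc n}. 1 - q ^ j)
      = c s * q ^ s * (1 - q ^ Suc n) * P s" if "s \<le> n" for s
    proof -
      have "{s<..Suc n} = insert (Suc n) {s<..n}" using that by auto
      then show ?thesis by (simp add: c_def P_def power_add mult_ac)
    qed
    then show ?thesis by simp
  qed
  also have "(\<Sum>s\<le>n. c s * q ^ s * (1 - q ^ Suc n) * P s)
     = (\<Sum>s\<le>n. c s * P s) - c n * q ^ n * q ^ Suc n"
    using telescope[of n] by (simp add: sum_subtractf P_n diff_eq_eq eq_diff_eq add.commute)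
  also have "(\<Sum>s\<le>n. c s * P s) = (\<Sum>k\<in>{- int n..int n}. (- 1) ^ nat \<bar>k\<bar> * q ^ pentagonal k)"
    using Suc.IH by (simp add: c_def P_def)
  also have "c n * q ^ n * q ^ Suc n = - ((- 1) ^ Suc n * q ^ pentagonal (int (Suc n)))"
  proof -
    have "pentagonal (int (Suc n)) = n * n + n * (n + 1) div 2 + n + Suc n"
    proof -
      have "2 * (n * (n + 1) div 2) = n * (n + 1)" by simp
      then have "2 * int (n * (n + 1) div 2) = int n * (int n + 1)"
        by (metis of_nat_1 of_nat_add of_nat_mult of_nat_numeral)
      then show ?thesis by (simp add: pentagonal_eq_iff algebra_simps)
    qed
    then show ?thesis by (simp only: c_def power_add) (simp add: mult_ac)
  qed
  also have "Suc n * Suc n + Suc n * (Suc n + 1) div 2 = pentagonal (- int (Suc n))"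
  proof -
    have "2 * (Suc n * (Suc n + 1) div 2) = Suc n * (Suc n + 1)" by simp
    then have "2 * int (Suc n * (Suc n + 1) div 2) = int (Suc n) * (int (Suc n) + 1)"
      by (metis of_nat_1 of_nat_add of_nat_mult of_nat_numeral)
    then have "pentagonal (- int (Suc n)) = Suc n * Suc n + Suc n * (Suc n + 1) div 2"
      unfolding pentagonal_eq_iff of_nat_add by (simp add: algebra_simps)
    then show ?thesis by simp
  qed
  also have "(\<Sum>k\<in>{- int n..int n}. (- 1) ^ nat \<bar>k\<bar> * q ^ pentagonal k)
        - - ((- 1) ^ Suc n * q ^ pentagonal (int (Suc n))) + (- 1) ^ Suc n * q ^ pentagonal (- int (Suc n))
      = (\<Sum>k\<in>{- int (Suc n)..int (Suc n)}. (- 1) ^ nat \<bar>k\<bar> * q ^ pentagonal k)"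
  proof -
    have range: "{- int (Suc n)..int (Suc n)} = insert (int (Suc n)) (insert (- int (Suc n)) {- int n..int n})"
      by auto
    have abs: "nat \<bar>int (Suc n)\<bar> = Suc n" "nat \<bar>- int (Suc n)\<bar> = Suc n"
      by simp_all
    have notin: "int (Suc n) \<notin> insert (- int (Suc n)) {- int n..int n}" "- int (Suc n) \<notin> {- int n..int n}"
      by auto
    show ?thesis
      unfolding range sum.insert [OF finite.insertI [OF finite_atLeastAtMost_int] notin(1)]
        sum.insert [OF finite_atLeastAtMost_int notin(2)] abs
      by (simp only: diff_minus_eq_add ac_simps)
  qed
  finally show ?case .
qed

text \<open>
  Expanding the product means choosing a set \<open>A\<close> of exponents, each at the cost of a sign. The
  truncation at \<open>n \<ge> N\<close> loses nothing since no part of a partition of \<open>N\<close> exceeds \<open>N\<close>.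
\<close>

lemma coeff_prod_one_minus_monom:
  assumes "N \<le> n"
  shows "coeff (\<Prod>j\<in>{0<..n}. 1 - monom 1 1 ^ j) N
       = (\<Sum>A\<in>distinct_partitions N. (- 1 :: 'a :: comm_ring_1) ^ card A)"
proof -
  have "(\<Prod>j\<in>{0<..n}. 1 - monom (1 :: 'a) 1 ^ j) = (\<Sum>A\<in>Pow {0<..n}. monom ((- 1) ^ card A) (\<Sum>A))"
  proof -
    have "(- 1) ^ card A * (\<Prod>j\<in>A. monom (1 :: 'a) 1 ^ j) = monom ((- 1) ^ card A) (\<Sum>A)" for A :: "nat set"
      unfolding power_sum [symmetric] by (simp add: monom_power minus_one_power_iff minus_monom)
    then show ?thesis by (simp add: prod_diff_conv_sum)
  qed
  then have "coeff (\<Prod>j\<in>{0<..n}. 1 - monom (1 :: 'a) 1 ^ j) N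
      = (\<Sum>A\<in>Pow {0<..n}. if \<Sum>A = N then (- 1) ^ card A else 0)"
    by (simp add: coeff_sum)
  also have "\<dots> = (\<Sum>A\<in>{A \<in> Pow {0<..n}. \<Sum>A = N}. (- 1) ^ card A)"
    by (rule sum.inter_filter [symmetric]) simp
  also have "{A \<in> Pow {0<..n}. \<Sum>A = N} = distinct_partitions N"
  proof -
    have "A \<subseteq> {0<..n}" if "finite A" "0 \<notin> A" "\<Sum>A = N" for A
    proof
      fix j assume "j \<in> A"
      then have "j \<le> \<Sum>A" using that member_le_sum [of j A "\<lambda>i. i"] by simp
      then show "j \<in> {0<..n}" using that assms \<open>j \<in> A\<close> by (cases "j = 0") auto
    qed
    then show ?thesis by (auto simp: distinct_partitions_def intro: finite_subset)
  qed
  finally show ?thesis .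
qed

text \<open>
  Compare the coefficients of \<open>q ^ N\<close> on both sides of Shanks's identity with \<open>n = N\<close>. On the left
  only the Euler product reaches degree \<open>N\<close>, and its coefficient is a signed count of the
  partitions; on the right there is at most one term of degree \<open>N\<close>. Signs disappear modulo 2.
\<close>

lemma odd_card_distinct_partitions_iff:
  "odd (card (distinct_partitions N)) \<longleftrightarrow> N \<in> range pentagonal"
proof -
  define q where "q = monom (1 :: int) 1"
  let ?lhs = "\<Sum>s\<le>N. (- 1) ^ s * q ^ (s * N + s * (s + 1) div 2) * (\<Prod>j\<in>{s<..N}. 1 - q ^ j)"
  let ?rhs = "\<Sum>k\<in>{- int N..int N}. (- 1) ^ nat \<bar>k\<bar> * q ^ pentagonal k"
  have "coeff ?lhs N = (\<Sum>A\<in>distinct_partitions N. (- 1) ^ card A)"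
  proof -
    have high: "coeff ((- 1) ^ s * q ^ (s * N + s * (s + 1) div 2) * r) N = 0" if "1 \<le> s" for s r
    proof -
      have "s * 2 \<le> s * (s + 1)" using that by simp
      then have "s \<le> s * (s + 1) div 2" by (subst less_eq_div_iff_mult_less_eq) simp_all
      moreover have "N \<le> s * N" using that by simp
      ultimately have "N < s * N + s * (s + 1) div 2" using that by linarith
      then show ?thesis
        by (cases "even s") (simp_all add: q_def monom_power coeff_monom_mult)
    qed
    have "{..N} = insert 0 {1..N}" by auto
    then have "coeff ?lhs N = coeff (\<Prod>j\<in>{0<..N}. 1 - q ^ j) N"
      using high by (simp add: coeff_sum)
    then show ?thesis by (simp only: q_def coeff_prod_one_minus_monom [OF order_refl])
  qed
  moreover have "odd (\<Sum>A\<in>distinct_partitions N. (- 1 :: int) ^ card A) \<longleftrightarrow> odd (card (distinct_partitions N))"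
    by (simp add: even_sum_iff finite_distinct_partitions)
  moreover have "odd (coeff ?rhs N) \<longleftrightarrow> N \<in> range pentagonal"
  proof -
    have "odd (coeff ((- 1) ^ nat \<bar>k\<bar> * q ^ pentagonal k) N) \<longleftrightarrow> pentagonal k = N" for k
      by (simp add: q_def monom_power minus_one_power_iff)
    then have "odd (coeff ?rhs N) \<longleftrightarrow> odd (card {k \<in> {- int N..int N}. pentagonal k = N})"
      by (simp add: coeff_sum even_sum_iff)
    also have "\<dots> \<longleftrightarrow> N \<in> range pentagonal"
    proof (cases "N \<in> range pentagonal")
      case True
      then obtain k where k: "N = pentagonal k" by blast
      then have "{l \<in> {- int N..int N}. pentagonal l = N} = {k}"
        using abs_le_pentagonal [of k] inj_pentagonal by (auto dest: injD)
      then show ?thesis using True by simp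
    next
      case False
      then have "{k \<in> {- int N..int N}. pentagonal k = N} = {}" by blast
      then have "card {k \<in> {- int N..int N}. pentagonal k = N} = 0" by (simp only: card.empty)
      then show ?thesis using False by simp
    qed
    finally show ?thesis .
  qed
  ultimately show ?thesis
    using finite_pentagonal_identity [of q N] by simp
qed

section \<open>Pentagonal numbers that are twice an odd number\<close>

text \<open>
  For odd \<open>n\<close> the equation \<open>k * (3 * k - 1) = 4 * n\<close> says that the left-hand side is 4 modulo 8,
  which among the residues of \<open>k\<close> modulo 8 happens for 4 and 7 only. Substituting \<open>k = 8 * j + 4\<close>
  gives the family starting with 11, and \<open>k = - (8 * j + 1)\<close> the one starting with 1.
\<close>

lemma odd_half_pentagonal_iff:
  "odd n \<and> 2 * n \<in> range pentagonal \<longleftrightarrow>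
    (\<exists>k::int. int n = 48 * k^2 + 14 * k + 1 \<or> int n = 48 * k^2 + 46 * k + 11)"
    (is "?pent \<longleftrightarrow> ?quad")
proof
  assume ?pent
  then obtain k where pent: "2 * n = pentagonal k" and "odd n" by blast
  have k: "k * (3 * k - 1) = 4 * int n"
    using double_pentagonal [of k] pent by linarith
  have "odd (int n)" using \<open>odd n\<close> by simp
  then obtain m where m: "int n = 2 * m + 1" by (rule oddE)
  define r where "r = k mod 8"
  define j where "j = k div 8"
  have k_eq: "k = 8 * j + r" and "0 \<le> r" "r < 8" by (simp_all add: r_def j_def)
  have "r * (3 * r - 1) = 4 + 8 * (m - j * (3 * (8 * j + r) - 1) - 3 * r * j)"
    using k m by (simp add: k_eq algebra_simps)
  then have "r * (3 * r - 1) mod 8 = 4" by presburger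
  moreover have "r \<in> {0, 1, 2, 3, 4, 5, 6, 7}"
    using \<open>0 \<le> r\<close> \<open>r < 8\<close> by auto
  ultimately consider "r = 4" | "r = 7" by auto
  then show ?quad
  proof cases
    case 1
    then have "int n = 48 * j^2 + 46 * j + 11"
      using k by (simp add: k_eq power2_eq_square algebra_simps)
    then show ?thesis by blast
  next
    case 2
    \<comment> \<open>The index \<open>- j - 1\<close> comes from \<open>8 * j + 7 = - (8 * (- j - 1) + 1)\<close>.\<close>
    then have "int n = 48 * (- j - 1)^2 + 14 * (- j - 1) + 1"
      using k by (simp add: k_eq power2_eq_square algebra_simps)
    then show ?thesis by blast
  qed
next
  assume ?quad
  then obtain k where "int n = 48 * k^2 + 14 * k + 1 \<or> int n = 48 * k^2 + 46 * k + 11" by blast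
  then show ?pent
  proof
    assume n: "int n = 48 * k^2 + 14 * k + 1"
    then have "odd (int n)" by simp
    moreover have "pentagonal (- (8 * k + 1)) = 2 * n"
      using n by (simp add: pentagonal_eq_iff power2_eq_square algebra_simps)
    ultimately show ?pent by (metis even_of_nat rangeI)
  next
    assume n: "int n = 48 * k^2 + 46 * k + 11"
    then have "odd (int n)" by simp
    moreover have "pentagonal (8 * k + 4) = 2 * n"
      using n by (simp add: pentagonal_eq_iff power2_eq_square algebra_simps)
    ultimately show ?pent by (metis even_of_nat rangeI)
  qed
qed

theorem theorem4p5:
  fixes n :: nat
  shows "[DSOME (2 * n) =
           (if \<exists>k::int. int n = 48 * k^2 + 14 * k + 1 \<or> int n = 48 * k^2 + 46 * k + 11
            then 2 else 0)] (mod 4)"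
proof -
  let ?c = "card (distinct_partitions (2 * n))"
  have "[2 * int m = (if odd m then 2 else 0)] (mod 4)" for m
    unfolding cong_def by (auto elim!: oddE evenE)
  from this [of "n * ?c"] have "[2 * int n * int ?c = (if odd (n * ?c) then 2 else 0)] (mod 4)"
    by (simp only: of_nat_mult mult.assoc)
  with DSOME_double_cong have "[DSOME (2 * n) = (if odd (n * ?c) then 2 else 0)] (mod 4)"
    by (rule cong_trans)
  moreover have "odd (n * ?c) \<longleftrightarrow>
      (\<exists>k::int. int n = 48 * k^2 + 14 * k + 1 \<or> int n = 48 * k^2 + 46 * k + 11)"
    using odd_half_pentagonal_iff [of n] odd_card_distinct_partitions_iff [of "2 * n"] by simp
  ultimately show ?thesis by (simp only:)
qed

end
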